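(* Let $f:\mathbb{R}^n\to\mathbb{R}\cup\{+\infty\}$ be a proper, lower semicontinuous piecewise function, with pieces $f_1,\dots,f_m$ on the sets $S_1,\dots,S_m$, and let each $f_i+\iota_{S_i}$ be prox-bounded with threshold $r_i$. Then the threshold of prox-boundedness of $f$ is $\bar r=\max_{1\le i\le m} r_i$.
   Context: $\mathbb{R}^n$ is equipped with an inner product and the induced norm $\|\cdot\|$. For $f:\mathbb{R}^n\to\mathbb{R}\cup\{+\infty\}$ and $r\ge 0$, the Moreau envelope of $f$ is $e_rf(x)=\inf_{y\in\mathbb{R}^n}\{f(y)+\frac r2\|y-x\|^2\}$. The function $f$ is prox-bounded if there exists $r\ge0$ such that $e_rf(x)>-\infty$ for some $x\in\mathbb{R}^n$; the infimum of all such $r\ge 0$ is called the threshold of prox-boundedness of $f$. Proper means not identically $+\infty$ and never $-\infty$. The indicator function of a set $S$ is $\iota_S(x)=0$ if $x\in S$ and $\iota_S(x)=+\infty$ if $x\notin S$. Piecewise function: given proper functions $f_i:\mathbb{R}^n\to\mathbb{R}\cup\{+\infty\}$, $i\in\{1,\dots,m\}$, and sets $S_1,\dots,S_m\subseteq\mathbb{R}^n$ with $\bigcup_i S_i=\mathbb{R}^n$ and $S_i\cap\operatorname{int}S_j=\varnothing$ for $i\ne j$, the piecewise function $f$ is defined by $f(x)=f_i(x)$ for $x\in S_i$. It is not required that $f_i=f_j$ on $S_i\cap S_j$; at points lying in several $S_i$ the value is the smallest of the corresponding $f_i(x)$, i.e. $f=\min_{1\le i\le m}(f_i+\iota_{S_i})$.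 *)

theory Defs
  imports "HOL-Analysis.Analysis"
begin

text \<open>
  Functions into \<open>\<real> \<union> {+\<infinity>}\<close> are modelled as functions into \<^typ>\<open>ereal\<close>; the value
  \<open>-\<infinity>\<close> is excluded by \<open>proper\<close>.  The space \<open>\<real>\<^sup>n\<close> with an inner product is a type of
  class \<^class>\<open>euclidean_space\<close>.
\<close>

definition proper :: "('a \<Rightarrow> ereal) \<Rightarrow> bool"
  where "proper f \<longleftrightarrow> (\<exists>x. f x \<noteq> \<infinity>) \<and> (\<forall>x. f x \<noteq> -\<infinity>)"

definition lower_semicontinuous :: "('a::topological_space \<Rightarrow> ereal) \<Rightarrow> bool"
  where "lower_semicontinuous f \<longleftrightarrow> (\<forall>x. f x \<le> Liminf (at x) f)"

definition indicator_fun :: "'a set \<Rightarrow> 'a \<Rightarrow> ereal"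
  where "indicator_fun S x = (if x \<in> S then 0 else \<infinity>)"

definition moreau_envelope :: "real \<Rightarrow> ('a::euclidean_space \<Rightarrow> ereal) \<Rightarrow> 'a \<Rightarrow> ereal"
  where "moreau_envelope r f x = (INF y. f y + ereal (r / 2 * (norm (y - x))\<^sup>2))"

definition prox_bounded :: "('a::euclidean_space \<Rightarrow> ereal) \<Rightarrow> bool"
  where "prox_bounded f \<longleftrightarrow> (\<exists>r\<ge>0. \<exists>x. moreau_envelope r f x > -\<infinity>)"

text \<open>
  The threshold is a real infimum, hence meaningful only together with \<^const>\<open>prox_bounded\<close>,
  which says that the set is nonempty.
\<close>

definition prox_threshold :: "('a::euclidean_space \<Rightarrow> ereal) \<Rightarrow> real"
  where "prox_threshold f = Inf {r. r \<ge> 0 \<and> (\<exists>x. moreau_envelope r f x > -\<infinity>)}"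

text \<open>
  The pieces need not agree on overlaps, where the smallest value is taken.  The
  covering condition forces \<open>m \<ge> 1\<close>, so the minimum is over a nonempty set.
\<close>

definition piecewise_function ::
  "nat \<Rightarrow> (nat \<Rightarrow> 'a::euclidean_space \<Rightarrow> ereal) \<Rightarrow> (nat \<Rightarrow> 'a set) \<Rightarrow> ('a \<Rightarrow> ereal) \<Rightarrow> bool"
  where "piecewise_function m fs S f \<longleftrightarrow>
    (\<forall>i\<in>{1..m}. proper (fs i)) \<and>
    (\<Union>i\<in>{1..m}. S i) = UNIV \<and>
    (\<forall>i\<in>{1..m}. \<forall>j\<in>{1..m}. i \<noteq> j \<longrightarrow> S i \<inter> interior (S j) = {}) \<and>
    (\<forall>x. f x = Min ((\<lambda>i. fs i x + indicator_fun (S i) x) ` {1..m}))"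

end

theory Submission
  imports Defs
begin

text \<open>
  Call \<open>r \<ge> 0\<close> admissible for \<open>g\<close> if the envelope of \<open>g\<close> with parameter \<open>r\<close> exceeds \<open>-\<infinity>\<close> at
  some point; the threshold of \<open>g\<close> is the infimum of its admissible parameters.  Write \<open>g\<^sub>i\<close> for the
  \<open>i\<close>-th piece plus the indicator of its set.  Since \<open>f\<close> is the pointwise minimum of finitely many
  \<open>g\<^sub>i\<close>, its envelope exceeds \<open>-\<infinity>\<close> at a point exactly when all envelopes of the \<open>g\<^sub>i\<close> do so at that
  same point (lemma \<open>moreau_envelope_Min_gt_minf_iff\<close>).

  Consequently a parameter admissible for \<open>f\<close> is admissible for every \<open>g\<^sub>i\<close>, so the threshold of
  \<open>f\<close> is at least every \<open>r\<^sub>i\<close>.  For the other inequality the points at which the envelopes of the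
  \<open>g\<^sub>i\<close> are controlled may differ from one \<open>i\<close> to another, and have to be made equal.  This is
  possible after an arbitrarily small increase of the parameter
  (lemma \<open>moreau_envelope_gt_minf_mono\<close>): two parabolas with different centres differ by a linear
  function, which a strictly larger curvature absorbs.  Hence for every \<open>t > max r\<^sub>i\<close> all envelopes
  with parameter \<open>t\<close> exceed \<open>-\<infinity>\<close> at the origin, and \<open>t\<close> is admissible for \<open>f\<close>.
\<close>

lemma moreau_envelope_gt_minf_iff:
  "moreau_envelope r g x > -\<infinity> \<longleftrightarrow>
    (\<exists>c::real. \<forall>y. ereal c \<le> g y + ereal (r / 2 * (norm (y - x))\<^sup>2))"
proof
  assume "moreau_envelope r g x > -\<infinity>"
  then obtain c where "ereal c < moreau_envelope r g x"
    using ereal_dense2 by blast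
  then have "ereal c \<le> g y + ereal (r / 2 * (norm (y - x))\<^sup>2)" for y
    unfolding moreau_envelope_def by (meson INF_lower UNIV_I less_imp_le order_trans)
  then show "\<exists>c::real. \<forall>y. ereal c \<le> g y + ereal (r / 2 * (norm (y - x))\<^sup>2)"
    by blast
next
  assume "\<exists>c::real. \<forall>y. ereal c \<le> g y + ereal (r / 2 * (norm (y - x))\<^sup>2)"
  then obtain c :: real where "\<And>y. ereal c \<le> g y + ereal (r / 2 * (norm (y - x))\<^sup>2)"
    by blast
  then have "ereal c \<le> moreau_envelope r g x"
    unfolding moreau_envelope_def by (blast intro: INF_greatest)
  then show "moreau_envelope r g x > -\<infinity>"
    by (rule less_le_trans[rotated]) simp
qed

text \<open>
  Put \<open>t = norm (y - z)\<close> and \<open>d = norm (z - x)\<close>.  By the triangle inequality the left-hand side is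
  at most \<open>r / 2 * (t + d)\<^sup>2\<close>, and the maximum over \<open>t\<close> of
  \<open>r / 2 * (t + d)\<^sup>2 - s / 2 * t\<^sup>2\<close> is the constant on the right, attained at
  \<open>t = r * d / (s - r)\<close>.
\<close>

lemma parabola_recentre:
  fixes x y z :: "'a::real_normed_vector"
  assumes "0 \<le> r" "r < s"
  shows "r / 2 * (norm (y - x))\<^sup>2 \<le>
    s / 2 * (norm (y - z))\<^sup>2 + r * s * (norm (z - x))\<^sup>2 / (2 * (s - r))"
proof -
  define t d where "t = norm (y - z)" and "d = norm (z - x)"
  have "norm (y - x) \<le> t + d"
    unfolding t_def d_def using norm_triangle_ineq[of "y - z" "z - x"] by simp
  then have "r / 2 * (norm (y - x))\<^sup>2 \<le> r / 2 * (t + d)\<^sup>2"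
    using \<open>0 \<le> r\<close> by (intro mult_left_mono power_mono) auto
  also have "\<dots> \<le> s / 2 * t\<^sup>2 + r * s * d\<^sup>2 / (2 * (s - r))"
  proof -
    have "s / 2 * t\<^sup>2 + r * s * d\<^sup>2 / (2 * (s - r)) - r / 2 * (t + d)\<^sup>2
        = ((s - r) * t - r * d)\<^sup>2 / (2 * (s - r))"
      using \<open>r < s\<close> by (simp add: field_simps power2_eq_square)
    also have "\<dots> \<ge> 0"
      using \<open>r < s\<close> by simp
    finally show ?thesis by simp
  qed
  finally show ?thesis
    unfolding t_def d_def .
qed

text \<open>
  The strict inequality \<open>r < s\<close> is essential when \<open>z \<noteq> x\<close>: on the real line \<open>g y = - (y - x)\<^sup>2\<close>
  has an envelope with parameter \<open>2\<close> that is finite at \<open>x\<close> and equal to \<open>-\<infinity>\<close> everywhere else.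
\<close>

lemma moreau_envelope_gt_minf_mono:
  fixes g :: "'a::euclidean_space \<Rightarrow> ereal"
  assumes "moreau_envelope r g x > -\<infinity>" "0 \<le> r" "r < s"
  shows "moreau_envelope s g z > -\<infinity>"
proof -
  define K where "K = r * s * (norm (z - x))\<^sup>2 / (2 * (s - r))"
  obtain c :: real where c: "\<And>y. ereal c \<le> g y + ereal (r / 2 * (norm (y - x))\<^sup>2)"
    using assms(1) unfolding moreau_envelope_gt_minf_iff by blast
  have "ereal (c - K) \<le> g y + ereal (s / 2 * (norm (y - z))\<^sup>2)" for y
    using c[of y] parabola_recentre[OF assms(2,3), of y x z]
    unfolding K_def[symmetric] by (cases "g y") auto
  then show ?thesis
    unfolding moreau_envelope_gt_minf_iff by blast
qed

lemma moreau_envelope_Min_gt_minf_iff: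
  fixes g :: "'i \<Rightarrow> 'a::euclidean_space \<Rightarrow> ereal"
  assumes "finite I" "I \<noteq> {}"
  shows "moreau_envelope r (\<lambda>y. Min ((\<lambda>i. g i y) ` I)) x > -\<infinity> \<longleftrightarrow>
    (\<forall>i\<in>I. moreau_envelope r (g i) x > -\<infinity>)"
proof
  assume *: "moreau_envelope r (\<lambda>y. Min ((\<lambda>i. g i y) ` I)) x > -\<infinity>"
  have "moreau_envelope r (\<lambda>y. Min ((\<lambda>i. g i y) ` I)) x \<le> moreau_envelope r (g i) x"
    if "i \<in> I" for i
    unfolding moreau_envelope_def using that assms by (intro INF_mono' add_right_mono) simp
  with * show "\<forall>i\<in>I. moreau_envelope r (g i) x > -\<infinity>"
    by (meson less_le_trans)
next
  assume "\<forall>i\<in>I. moreau_envelope r (g i) x > -\<infinity>"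
  then obtain c :: "'i \<Rightarrow> real"
    where c: "\<And>i y. i \<in> I \<Longrightarrow> ereal (c i) \<le> g i y + ereal (r / 2 * (norm (y - x))\<^sup>2)"
    unfolding moreau_envelope_gt_minf_iff by metis
  have "ereal (Min (c ` I)) \<le> Min ((\<lambda>i. g i y) ` I) + ereal (r / 2 * (norm (y - x))\<^sup>2)" for y
  proof -
    have "Min ((\<lambda>i. g i y) ` I) \<in> (\<lambda>i. g i y) ` I"
      using assms by (intro Min_in) auto
    then obtain i where i: "i \<in> I" "Min ((\<lambda>i. g i y) ` I) = g i y"
      by blast
    have "ereal (Min (c ` I)) \<le> ereal (c i)"
      using assms i(1) by simp
    with c[OF i(1), of y] show ?thesis
      unfolding i(2) by (rule order_trans[rotated])
  qed
  then show "moreau_envelope r (\<lambda>y. Min ((\<lambda>i. g i y) ` I)) x > -\<infinity>"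
    unfolding moreau_envelope_gt_minf_iff by blast
qed

lemma prox_threshold_le:
  assumes "r \<ge> 0" "moreau_envelope r g x > -\<infinity>"
  shows "prox_threshold g \<le> r"
  unfolding prox_threshold_def using assms by (intro cInf_lower bdd_belowI[of _ 0]) auto

lemma prox_threshold_nonneg:
  assumes "prox_bounded g"
  shows "prox_threshold g \<ge> 0"
  unfolding prox_threshold_def
  using assms by (intro cInf_greatest) (auto simp: prox_bounded_def)

lemma moreau_envelope_gt_minf_above_threshold:
  assumes "prox_bounded g" "prox_threshold g < s"
  shows "moreau_envelope s g z > -\<infinity>"
proof -
  have "{r. r \<ge> 0 \<and> (\<exists>x. moreau_envelope r g x > -\<infinity>)} \<noteq> {}"
    using assms(1) by (auto simp: prox_bounded_def)
  then obtain r x where "r \<ge> 0" "moreau_envelope r g x > -\<infinity>" "r < s"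
    using cInf_lessD[of "{r. r \<ge> 0 \<and> (\<exists>x. moreau_envelope r g x > -\<infinity>)}" s] assms(2)
    unfolding prox_threshold_def by blast
  then show ?thesis
    by (blast intro: moreau_envelope_gt_minf_mono)
qed

theorem theorem3p3:
  fixes f :: "'a::euclidean_space \<Rightarrow> ereal"
    and fs :: "nat \<Rightarrow> 'a \<Rightarrow> ereal"
    and S :: "nat \<Rightarrow> 'a set"
    and r :: "nat \<Rightarrow> real"
    and m :: nat
  assumes "proper f"
    and "lower_semicontinuous f"
    and "piecewise_function m fs S f"
    and "\<And>i. i \<in> {1..m} \<Longrightarrow> prox_bounded (\<lambda>x. fs i x + indicator_fun (S i) x)"
    and "\<And>i. i \<in> {1..m} \<Longrightarrow> prox_threshold (\<lambda>x. fs i x + indicator_fun (S i) x) = r i"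
  shows "prox_bounded f \<and> prox_threshold f = Max (r ` {1..m})"
proof -
  define g where "g = (\<lambda>i x. fs i x + indicator_fun (S i) x)"
  define M where "M = Max (r ` {1..m})"
  have bounded: "prox_bounded (g i)" and threshold: "prox_threshold (g i) = r i"
    if "i \<in> {1..m}" for i
    using assms(4,5)[OF that] by (simp_all add: g_def)
  have nonempty: "{1..m} \<noteq> {}"
    using assms(3) unfolding piecewise_function_def by blast
  have f_eq: "f = (\<lambda>x. Min ((\<lambda>i. g i x) ` {1..m}))"
    using assms(3) unfolding piecewise_function_def g_def by blast
  have envelope_f: "moreau_envelope s f x > -\<infinity> \<longleftrightarrow>
      (\<forall>i\<in>{1..m}. moreau_envelope s (g i) x > -\<infinity>)" for s x
    unfolding f_eq using nonempty by (intro moreau_envelope_Min_gt_minf_iff) auto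
  have r_le_M: "r i \<le> M" if "i \<in> {1..m}" for i
    using that by (simp add: M_def)
  have "M \<ge> 0"
  proof -
    obtain i where "i \<in> {1..m}"
      using nonempty by blast
    then show ?thesis
      using prox_threshold_nonneg[OF bounded, of i] threshold r_le_M by fastforce
  qed
  have admissible: "moreau_envelope s f 0 > -\<infinity>" if "s > M" for s
    unfolding envelope_f
  proof
    fix i assume "i \<in> {1..m}"
    then show "moreau_envelope s (g i) 0 > -\<infinity>"
      using that r_le_M[of i] threshold[of i]
      by (intro moreau_envelope_gt_minf_above_threshold bounded) auto
  qed
  have bounded_f: "prox_bounded f"
    unfolding prox_bounded_def using admissible[of "M + 1"] \<open>M \<ge> 0\<close>
    by (intro exI[of _ "M + 1"]) auto
  have "M \<le> prox_threshold f"
    unfolding prox_threshold_def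
  proof (rule cInf_greatest)
    show "{s. s \<ge> 0 \<and> (\<exists>x. moreau_envelope s f x > -\<infinity>)} \<noteq> {}"
      using bounded_f by (auto simp: prox_bounded_def)
  next
    fix s assume "s \<in> {s. s \<ge> 0 \<and> (\<exists>x. moreau_envelope s f x > -\<infinity>)}"
    then obtain x where "s \<ge> 0" "moreau_envelope s f x > -\<infinity>"
      by blast
    then have "r i \<le> s" if "i \<in> {1..m}" for i
      using that threshold[OF that] prox_threshold_le[of s "g i" x] envelope_f by auto
    then show "M \<le> s"
      unfolding M_def using nonempty by (intro Max.boundedI) auto
  qed
  moreover have "prox_threshold f \<le> M"
  proof (rule dense_ge)
    fix s assume "M < s"
    with \<open>M \<ge> 0\<close> show "prox_threshold f \<le> s"
      by (intro prox_threshold_le[of s f 0] admissible) simp_all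
  qed
  ultimately show ?thesis
    using bounded_f by (simp add: M_def)
qed

end
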